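(* Let $G$ and $H$ be graphs of coprime orders, each with at least one edge. Then $$\kappa(G\times H)\leq\kappa(G)\kappa(H),$$ where $G\times H$ denotes the weak product. In particular, if $\operatorname{FR}_{\min}(G)=\mathcal E(G)/\sqrt{2s_G}$ and $\operatorname{FR}_{\min}(H)=\mathcal E(H)/\sqrt{2s_H}$, then $\operatorname{FR}_{\min}(G\times H)=\mathcal E(G\times H)/\sqrt{2s_{G\times H}}$.
   Context: Graphs are finite, simple and undirected; $s_G$ denotes the number of edges of $G$. The weak product $G\times H$ has vertex set $V(G)\times V(H)$, and $(g_1,h_1)$ is adjacent to $(g_2,h_2)$ if and only if $g_1$ is adjacent to $g_2$ in $G$ and $h_1$ is adjacent to $h_2$ in $H$. A vertex labeling of a graph $G=(V,E)$ of order $N=|V|$ is a bijection $\sigma:V\to\mathbb Z_N=\mathbb Z/N\mathbb Z$. The adjacency matrix under $\sigma$ is the $N\times N$ matrix $A_\sigma$, indexed by $\mathbb Z_N\times\mathbb Z_N$, with $(A_\sigma)_{x,y}=1$ if the vertices labeled $x$ and $y$ are adjacent and $0$ otherwise. $F$ is the unitary Fourier matrix $F_{mx}=\frac1{\sqrt N}e^{-2\pi i mx/N}$. The Fourier ratio of a nonzero $N\times N$ matrix $M$ is $\operatorname{FR}(M)=\|FMF\|_1/\|FMF\|_2$, where $\|\cdot\|_1$ is the entrywise $\ell^1$-norm and $\|\cdot\|_2$ the Frobenius norm. The edge complexity of a graph with at least one edge is $\operatorname{FR}_{\min}(G)=\min_\sigma\operatorname{FR}(A_\sigma)$, the minimum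 over all vertex labelings (by $\mathbb Z_N$ with $N$ the order of that graph). The graph energy $\mathcal E(G)$ is the sum of the absolute values of the adjacency eigenvalues counted with multiplicity. The energy-gap factor of a graph with $s_G>0$ is $\kappa(G)=\operatorname{FR}_{\min}(G)\big/\bigl(\mathcal E(G)/\sqrt{2s_G}\bigr)$. *)

theory Defs
  imports
    Complex_Main
    "Graph_Theory.Pair_Digraph"
    "Jordan_Normal_Form.Spectral_Radius"
begin

text \<open>
  A finite simple undirected graph is a \<^locale>\<open>pair_graph\<close>: finite vertex set, and a
  symmetric irreflexive adjacency relation \<open>parcs\<close> on it.  Every undirected edge
  thus occurs in \<open>parcs\<close> with both orientations.
\<close>

definition num_edges :: "'a pair_pre_digraph \<Rightarrow> nat" where
  "num_edges G = card ((\<lambda>(u, v). {u, v}) ` parcs G)"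

definition weak_product ::
    "'a pair_pre_digraph \<Rightarrow> 'b pair_pre_digraph \<Rightarrow> ('a \<times> 'b) pair_pre_digraph"
    (infixl \<open>\<times>\<^sub>w\<close> 70) where
  "G \<times>\<^sub>w H =
     \<lparr> pverts = pverts G \<times> pverts H,
       parcs = {((g1, h1), (g2, h2)) | g1 h1 g2 h2. (g1, g2) \<in> parcs G \<and> (h1, h2) \<in> parcs H} \<rparr>"

lemma pair_graph_weak_product:
  assumes "pair_graph G" "pair_graph H"
  shows "pair_graph (G \<times>\<^sub>w H)"
proof -
  interpret G: pair_graph G by fact
  interpret H: pair_graph H by fact
  have G: "sym (parcs G)" and H: "sym (parcs H)"
    using G.sym_arcs H.sym_arcs by (simp_all add: symmetric_def)
  have fin: "finite (parcs (G \<times>\<^sub>w H))"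
    by (rule finite_subset[of _ "(pverts G \<times> pverts H) \<times> (pverts G \<times> pverts H)"])
       (auto simp: weak_product_def dest: G.in_arcsD1 G.in_arcsD2 H.in_arcsD1 H.in_arcsD2)
  have "sym (parcs (G \<times>\<^sub>w H))"
    using G H by (auto simp: weak_product_def sym_def)
  then have sym: "symmetric (with_proj (G \<times>\<^sub>w H))"
    by (simp add: symmetric_def arcs_ends_def arc_to_ends_def with_proj_def)
  show ?thesis
    using fin sym
    by unfold_locales
       (auto simp: weak_product_def dest: G.in_arcsD1 G.in_arcsD2 H.in_arcsD1 H.in_arcsD2
         G.no_loops H.no_loops)
qed

text \<open>
  The residue ring \<open>\<int>/N\<int>\<close> is represented by the residues \<open>{..<N}\<close>, which are also
  the index range of the \<open>N \<times> N\<close> matrices.  Labelings are extensional, so that they are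
  genuinely functions on the vertex set.
\<close>

definition vertex_labelings :: "'a pair_pre_digraph \<Rightarrow> ('a \<Rightarrow> nat) set" where
  "vertex_labelings G =
     {\<sigma> \<in> extensional (pverts G). bij_betw \<sigma> (pverts G) {..<card (pverts G)}}"

definition adj_mat :: "'a pair_pre_digraph \<Rightarrow> ('a \<Rightarrow> nat) \<Rightarrow> complex mat" where
  "adj_mat G \<sigma> = mat (card (pverts G)) (card (pverts G))
     (\<lambda>(x, y). if (inv_into (pverts G) \<sigma> x, inv_into (pverts G) \<sigma> y) \<in> parcs G then 1 else 0)"

definition fourier_mat :: "nat \<Rightarrow> complex mat" where
  "fourier_mat N = mat N N
     (\<lambda>(m, x). complex_of_real (1 / sqrt (real N)) *
        exp (- 2 * complex_of_real pi * \<i> * of_nat m * of_nat x / of_nat N))"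

definition entrywise_l1_norm :: "complex mat \<Rightarrow> real" where
  "entrywise_l1_norm M = (\<Sum>i<dim_row M. \<Sum>j<dim_col M. cmod (M $$ (i, j)))"

definition frobenius_norm :: "complex mat \<Rightarrow> real" where
  "frobenius_norm M = sqrt (\<Sum>i<dim_row M. \<Sum>j<dim_col M. (cmod (M $$ (i, j)))\<^sup>2)"

definition fourier_ratio :: "complex mat \<Rightarrow> real" where
  "fourier_ratio M =
     (let M' = fourier_mat (dim_row M) * M * fourier_mat (dim_row M)
      in entrywise_l1_norm M' / frobenius_norm M')"

definition edge_complexity :: "'a pair_pre_digraph \<Rightarrow> real" where
  "edge_complexity G = Min ((\<lambda>\<sigma>. fourier_ratio (adj_mat G \<sigma>)) ` vertex_labelings G)"

text \<open>The minimum is over a finite nonempty set, so \<open>Min\<close> is meaningful.\<close>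

lemma finite_vertex_labelings:
  assumes "finite (pverts G)"
  shows "finite (vertex_labelings G)"
proof (rule finite_subset)
  show "vertex_labelings G \<subseteq> pverts G \<rightarrow>\<^sub>E {..<card (pverts G)}"
    by (auto simp: vertex_labelings_def PiE_def dest: bij_betwE)
  show "finite (pverts G \<rightarrow>\<^sub>E {..<card (pverts G)})"
    using assms by (intro finite_PiE) auto
qed

lemma vertex_labelings_nonempty:
  assumes "finite (pverts G)"
  shows "vertex_labelings G \<noteq> {}"
proof -
  obtain f where f: "bij_betw f (pverts G) {..<card (pverts G)}"
    using ex_bij_betw_finite_nat[OF assms] by (auto simp: atLeast0LessThan)
  then have "bij_betw (restrict f (pverts G)) (pverts G) {..<card (pverts G)}"
    by (subst bij_betw_cong[of _ _ f]) auto
  then have "restrict f (pverts G) \<in> vertex_labelings G"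
    by (simp add: vertex_labelings_def)
  then show ?thesis by blast
qed

text \<open>Eigenvalues are counted with algebraic multiplicity, as roots of the characteristic polynomial.\<close>

definition mat_energy :: "complex mat \<Rightarrow> real" where
  "mat_energy M = (\<Sum>\<mu>\<in>spectrum M. real (order \<mu> (char_poly M)) * cmod \<mu>)"

definition graph_energy :: "'a pair_pre_digraph \<Rightarrow> real" where
  "graph_energy G = mat_energy (adj_mat G (SOME \<sigma>. \<sigma> \<in> vertex_labelings G))"

text \<open>The energy does not depend on the labeling chosen in its definition.\<close>

lemma similar_adj_mat:
  assumes \<sigma>: "\<sigma> \<in> vertex_labelings G" and \<tau>: "\<tau> \<in> vertex_labelings G"
  shows "similar_mat (adj_mat G \<sigma>) (adj_mat G \<tau>)"
proof -
  define V N where "V = pverts G" and "N = card (pverts G)"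
  have bs: "bij_betw \<sigma> V {..<N}" and bt: "bij_betw \<tau> V {..<N}"
    using assms by (auto simp: vertex_labelings_def V_def N_def)
  define p where "p x = \<tau> (inv_into V \<sigma> x)" for x
  have bp: "bij_betw p {..<N} {..<N}"
    unfolding p_def using bij_betw_trans[OF bij_betw_inv_into[OF bs] bt] by (simp add: comp_def)
  have plt: "p x < N" if "x < N" for x using bp that by (auto dest: bij_betwE)
  have pinj: "p x = p y \<longleftrightarrow> x = y" if "x < N" "y < N" for x y
    using bp that by (auto simp: bij_betw_def inj_on_def)
  have inv_p: "inv_into V \<tau> (p x) = inv_into V \<sigma> x" if "x < N" for x
  proof -
    have "inv_into V \<sigma> x \<in> V"
      using bij_betwE[OF bij_betw_inv_into[OF bs]] that by auto
    then show ?thesis unfolding p_def using bt by (simp add: bij_betw_def inv_into_f_f)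
  qed
  define A B P Q :: "complex mat" where
    "A = adj_mat G \<sigma>" and "B = adj_mat G \<tau>" and
    "P = mat N N (\<lambda>(x, y). if p x = y then 1 else 0)" and
    "Q = mat N N (\<lambda>(x, y). if p y = x then 1 else 0)"
  have carr: "A \<in> carrier_mat N N" "B \<in> carrier_mat N N"
    "P \<in> carrier_mat N N" "Q \<in> carrier_mat N N"
    by (auto simp: A_def B_def P_def Q_def adj_mat_def N_def)
  have PQ: "P * Q = 1\<^sub>m N"
    by (rule eq_matI)
       (auto simp: P_def Q_def scalar_prod_def pinj plt if_distrib[where f = "\<lambda>x. x * _"] cong: if_cong)
  have QP: "Q * P = 1\<^sub>m N"
    using mat_mult_left_right_inverse[OF carr(3,4) PQ] .
  have AB: "A $$ (x, y) = B $$ (p x, p y)" if "x < N" "y < N" for x y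
    using that plt inv_p by (simp add: A_def B_def adj_mat_def N_def V_def)
  have PB: "(P * B) $$ (x, z) = B $$ (p x, z)" if "x < N" "z < N" for x z
    using that carr plt
    by (auto simp: P_def scalar_prod_def if_distrib[where f = "\<lambda>x. x * _"] cong: if_cong)
  have "A = P * B * Q"
  proof (rule eq_matI)
    fix x y assume "x < dim_row (P * B * Q)" "y < dim_col (P * B * Q)"
    then have xy: "x < N" "y < N" using carr by auto
    have "(P * B * Q) $$ (x, y) = (\<Sum>z<N. (P * B) $$ (x, z) * Q $$ (z, y))"
      using xy carr by (simp add: scalar_prod_def atLeast0LessThan del: assoc_mult_mat)
    also have "\<dots> = (\<Sum>z<N. if p y = z then B $$ (p x, z) else 0)"
      using xy by (intro sum.cong) (auto simp: PB Q_def)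
    also have "\<dots> = A $$ (x, y)" using xy plt by (simp add: AB)
    finally show "A $$ (x, y) = (P * B * Q) $$ (x, y)" ..
  qed (use carr in auto)
  then have "similar_mat_wit A B P Q"
    using PQ QP carr by (intro similar_mat_witI[of _ _ N]) auto
  then show ?thesis unfolding similar_mat_def A_def B_def by blast
qed

lemma graph_energy_eq:
  assumes "\<sigma> \<in> vertex_labelings G"
  shows "graph_energy G = mat_energy (adj_mat G \<sigma>)"
proof -
  have "similar_mat (adj_mat G (SOME \<sigma>. \<sigma> \<in> vertex_labelings G)) (adj_mat G \<sigma>)"
    by (rule similar_adj_mat[OF someI[of "\<lambda>\<sigma>. \<sigma> \<in> vertex_labelings G", OF assms] assms])
  then have "char_poly (adj_mat G (SOME \<sigma>. \<sigma> \<in> vertex_labelings G)) = char_poly (adj_mat G \<sigma>)"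
    by (rule char_poly_similar)
  moreover have "spectrum (adj_mat G \<tau>) = {\<mu>. poly (char_poly (adj_mat G \<tau>)) \<mu> = 0}" for \<tau>
    using eigenvalue_root_char_poly[of "adj_mat G \<tau>" "card (pverts G)"]
    by (auto simp: spectrum_def adj_mat_def)
  ultimately show ?thesis by (simp add: graph_energy_def mat_energy_def)
qed

definition energy_gap :: "'a pair_pre_digraph \<Rightarrow> real" where
  "energy_gap G = edge_complexity G / (graph_energy G / sqrt (2 * real (num_edges G)))"

end

theory Submission
  imports Defs "HOL-Number_Theory.Cong"
begin

text \<open>
  Let \<open>n\<close>, \<open>m\<close> be the orders of \<open>G\<close>, \<open>H\<close>.  Given labelings of \<open>G\<close> and \<open>H\<close>, label the vertex of the
  weak product with labels \<open>(a, b)\<close> by \<open>a m + b n mod n m\<close>.  Then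
  \<open>e(- k (a m + b n) / (n m)) = e(- k a / n) e(- k b / m)\<close>, so by the Chinese remainder theorem
  the Fourier transform of the product adjacency matrix is, up to relabeling frequencies \<open>k\<close> as
  \<open>(k mod n, k mod m)\<close>, the tensor product of the two transforms, and Fourier ratios multiply.
  Energies and doubled edge numbers multiply as well, which gives the inequality.

  For the equality case one needs the general bound that the energy of \<open>A\<close> is at most the entrywise
  \<open>\<ell>\<^sup>1\<close>-norm of \<open>F A F\<close>: by unitary triangularization the eigenvalues of \<open>A\<close> are the numbers
  \<open>x\<^sub>i\<^sup>* (F A F) y\<^sub>i\<close> for two orthonormal bases \<open>x\<close>, \<open>y\<close>, and
  \<open>\<Sum>\<^sub>i |x\<^sub>i(k)| |y\<^sub>i(l)| \<le> 1\<close> for all \<open>k\<close>, \<open>l\<close>.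
\<close>

section \<open>Unitary matrices\<close>

definition unitary_mat :: "nat \<Rightarrow> complex mat \<Rightarrow> bool" where
  "unitary_mat n U \<longleftrightarrow> U \<in> carrier_mat n n \<and> mat_adjoint U * U = 1\<^sub>m n"

lemma mat_adjoint_dim [simp]:
  "dim_row (mat_adjoint A) = dim_col A" "dim_col (mat_adjoint A) = dim_row A"
  by (simp_all add: mat_adjoint_def)

lemma mat_adjoint_index [simp]:
  "i < dim_col A \<Longrightarrow> j < dim_row A \<Longrightarrow> mat_adjoint A $$ (i, j) = conjugate (A $$ (j, i))"
  by (simp add: mat_adjoint_def mat_of_rows_index)

lemma mat_adjoint_carrier [simp]:
  "A \<in> carrier_mat m n \<Longrightarrow> mat_adjoint A \<in> carrier_mat n m"
  unfolding carrier_mat_def by simp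

lemma mat_adjoint_mat_adjoint [simp]:
  "mat_adjoint (mat_adjoint A) = (A :: complex mat)"
  by (rule eq_matI) auto

lemma index_mult_mat_sum:
  assumes "A \<in> carrier_mat m n" "B \<in> carrier_mat n k" "i < m" "j < k"
  shows "(A * B) $$ (i, j) = (\<Sum>l<n. A $$ (i, l) * B $$ (l, j))"
  using assms by (auto simp: scalar_prod_def atLeast0LessThan intro!: sum.cong)

lemma mat_adjoint_mult:
  fixes A B :: "complex mat"
  assumes A: "A \<in> carrier_mat m n" and B: "B \<in> carrier_mat n k"
  shows "mat_adjoint (A * B) = mat_adjoint B * mat_adjoint A"
proof (rule eq_matI)
  fix i j assume "i < dim_row (mat_adjoint B * mat_adjoint A)" "j < dim_col (mat_adjoint B * mat_adjoint A)"
  then have ij: "i < k" "j < m" using A B by auto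
  have "mat_adjoint (A * B) $$ (i, j) = cnj ((A * B) $$ (j, i))"
    using ij A B by (subst mat_adjoint_index) auto
  also have "\<dots> = (\<Sum>l<n. mat_adjoint B $$ (i, l) * mat_adjoint A $$ (l, j))"
    unfolding index_mult_mat_sum[OF A B ij(2,1)] cnj_sum
    using ij A B by (intro sum.cong) (auto simp: mult.commute)
  also have "\<dots> = (mat_adjoint B * mat_adjoint A) $$ (i, j)"
    by (rule index_mult_mat_sum[symmetric, of _ k n _ m]) (use ij A B in auto)
  finally show "mat_adjoint (A * B) $$ (i, j) = (mat_adjoint B * mat_adjoint A) $$ (i, j)" .
qed (use A B in auto)

lemma unitary_mat_carrier: "unitary_mat n U \<Longrightarrow> U \<in> carrier_mat n n"
  by (simp add: unitary_mat_def)

text \<open>\<open>unitary_mat\<close> asks for a left inverse only; for square matrices over a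
  field it is two-sided.\<close>

lemma unitary_mat_right:
  assumes "unitary_mat n U"
  shows "U * mat_adjoint U = 1\<^sub>m n"
  using assms mat_mult_left_right_inverse[of "mat_adjoint U" n U] by (simp add: unitary_mat_def)

lemma unitary_mat_adjoint:
  assumes "unitary_mat n U"
  shows "unitary_mat n (mat_adjoint U)"
  using assms unitary_mat_right[OF assms] by (simp add: unitary_mat_def)

lemma unitary_mat_mult:
  assumes U: "unitary_mat n U" and V: "unitary_mat n V"
  shows "unitary_mat n (U * V)"
proof -
  have c: "U \<in> carrier_mat n n" "V \<in> carrier_mat n n"
    using assms by (simp_all add: unitary_mat_def)
  have "mat_adjoint (U * V) * (U * V) = mat_adjoint V * (mat_adjoint U * U) * V"
    using c by (simp add: mat_adjoint_mult[OF c] assoc_mult_mat[of _ n n _ n _ n]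
        mult_carrier_mat[of _ n n _ n])
  then show ?thesis
    using assms c by (simp add: unitary_mat_def)
qed

lemma unitary_mat_col_norm:
  assumes "unitary_mat n U" "j < n"
  shows "(\<Sum>i<n. (cmod (U $$ (i, j)))\<^sup>2) = 1"
proof -
  have c: "U \<in> carrier_mat n n" using assms by (simp add: unitary_mat_def)
  have "complex_of_real (\<Sum>i<n. (cmod (U $$ (i, j)))\<^sup>2) = (mat_adjoint U * U) $$ (j, j)"
    using c assms(2)
    by (subst index_mult_mat_sum[of _ n n _ n])
       (auto simp del: of_real_power simp add: complex_norm_square mult.commute)
  also have "\<dots> = 1" using assms by (simp add: unitary_mat_def)
  finally show ?thesis by (metis of_real_eq_1_iff)
qed

text \<open>The rows of U are, up to conjugation, the columns of its adjoint, which is unitary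
  too.\<close>

lemma unitary_mat_row_norm:
  assumes "unitary_mat n U" "i < n"
  shows "(\<Sum>j<n. (cmod (U $$ (i, j)))\<^sup>2) = 1"
proof -
  have c: "U \<in> carrier_mat n n" using assms by (simp add: unitary_mat_def)
  show ?thesis
    using unitary_mat_col_norm[OF unitary_mat_adjoint[OF assms(1)] assms(2)] c assms(2) by simp
qed

text \<open>Multiplication by U leaves the Gram matrix \<open>mat_adjoint A * A\<close> fixed, and
  the diagonal of that matrix carries the squared column norms.\<close>

lemma frobenius_norm_unitary_left:
  assumes U: "unitary_mat n U" and A: "A \<in> carrier_mat n m"
  shows "frobenius_norm (U * A) = frobenius_norm A"
proof -
  have c: "U \<in> carrier_mat n n" using U by (simp add: unitary_mat_def)
  have gram: "complex_of_real (\<Sum>i<n. (cmod (B $$ (i, j)))\<^sup>2) = (mat_adjoint B * B) $$ (j, j)"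
    if "B \<in> carrier_mat n m" "j < m" for B j
    using that by (subst index_mult_mat_sum[of _ m n _ m])
       (auto simp del: of_real_power simp add: complex_norm_square mult.commute)
  have cU: "mat_adjoint U \<in> carrier_mat n n" and cA: "mat_adjoint A \<in> carrier_mat m n"
    using c A by simp_all
  have "mat_adjoint (U * A) * (U * A) = mat_adjoint A * (mat_adjoint U * (U * A))"
    unfolding mat_adjoint_mult[OF c A]
    by (rule assoc_mult_mat[OF cA cU mult_carrier_mat[OF c A]])
  also have "mat_adjoint U * (U * A) = mat_adjoint U * U * A"
    by (rule assoc_mult_mat[OF cU c A, symmetric])
  also have "\<dots> = A" using U A by (simp add: unitary_mat_def)
  finally have "complex_of_real (\<Sum>i<n. (cmod ((U * A) $$ (i, j)))\<^sup>2)
      = complex_of_real (\<Sum>i<n. (cmod (A $$ (i, j)))\<^sup>2)" if "j < m" for j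
    using gram[OF mult_carrier_mat[OF c A] that] gram[OF A that] by simp
  then have "(\<Sum>i<n. (cmod ((U * A) $$ (i, j)))\<^sup>2) = (\<Sum>i<n. (cmod (A $$ (i, j)))\<^sup>2)"
    if "j < m" for j
    using that of_real_eq_iff by blast
  then have "(\<Sum>j<m. \<Sum>i<n. (cmod ((U * A) $$ (i, j)))\<^sup>2) = (\<Sum>j<m. \<Sum>i<n. (cmod (A $$ (i, j)))\<^sup>2)"
    by simp
  then have "(\<Sum>i<n. \<Sum>j<m. (cmod ((U * A) $$ (i, j)))\<^sup>2) = (\<Sum>i<n. \<Sum>j<m. (cmod (A $$ (i, j)))\<^sup>2)"
    by (subst (1 2) sum.swap)
  then show ?thesis
    using c A by (simp add: frobenius_norm_def del: index_mult_mat(1))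
qed

lemma frobenius_norm_adjoint: "frobenius_norm (mat_adjoint A) = frobenius_norm A"
  unfolding frobenius_norm_def by (subst sum.swap) simp

lemma frobenius_norm_unitary_right:
  assumes U: "unitary_mat n U" and A: "A \<in> carrier_mat m n"
  shows "frobenius_norm (A * U) = frobenius_norm A"
proof -
  have "frobenius_norm (A * U) = frobenius_norm (mat_adjoint U * mat_adjoint A)"
    using frobenius_norm_adjoint[of "A * U"] mat_adjoint_mult[OF A unitary_mat_carrier[OF U]]
    by simp
  also have "\<dots> = frobenius_norm A"
    using frobenius_norm_unitary_left[OF unitary_mat_adjoint[OF U] mat_adjoint_carrier[OF A]]
    by (simp add: frobenius_norm_adjoint)
  finally show ?thesis .
qed

section \<open>Energy read off a triangular form\<close>

lemma sum_list_count:
  fixes f :: "'b \<Rightarrow> real"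
  assumes "set xs \<subseteq> X" "finite X"
  shows "(\<Sum>x\<leftarrow>xs. f x) = (\<Sum>x\<in>X. real (count_list xs x) * f x)"
  using assms(1)
proof (induction xs)
  case (Cons a xs)
  have "(\<Sum>x\<in>X. real (count_list (a # xs) x) * f x)
      = (\<Sum>x\<in>X. real (count_list xs x) * f x + (if a = x then f x else 0))"
    by (intro sum.cong) (auto simp: algebra_simps)
  also have "\<dots> = (\<Sum>x\<leftarrow>xs. f x) + f a"
    using Cons assms(2) by (simp add: sum.distrib)
  finally show ?case by simp
qed simp

text \<open>Similarity preserves the characteristic polynomial, which for a triangular matrix splits
  into linear factors at the diagonal entries. The algebraic multiplicity of an eigenvalue is thus
  the number of its occurrences on the diagonal.\<close>

lemma mat_energy_upper_triangular:
  assumes sim: "similar_mat A B" and A: "A \<in> carrier_mat n n" and ut: "upper_triangular B"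
  shows "mat_energy A = (\<Sum>i<n. cmod (B $$ (i, i)))"
proof -
  have B: "B \<in> carrier_mat n n"
    using sim A by (auto simp: similar_mat_def dest: similar_mat_witD2)
  define as where "as = diag_mat B"
  have cp: "char_poly A = (\<Prod>a\<leftarrow>as. [:- a, 1:])"
    using char_poly_similar[OF sim] char_poly_upper_triangular[OF B ut] by (simp add: as_def)
  \<comment> \<open>The order is additive on nonzero products, and each linear factor has order 1 at
    its own root and 0 elsewhere.\<close>
  have ord: "order \<mu> (\<Prod>a\<leftarrow>bs. [:- a, 1:]) = count_list bs \<mu>" for \<mu> :: complex and bs
  proof (induction bs)
    case (Cons b bs)
    have nz: "(\<Prod>a\<leftarrow>bs. [:- a, 1:]) \<noteq> 0" by (auto simp: prod_list_zero_iff)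
    then have "[:- b, 1:] * (\<Prod>a\<leftarrow>bs. [:- a, 1:]) \<noteq> 0"
      unfolding mult_eq_0_iff by simp
    from order_mult[OF this, of \<mu>] Cons show ?case by (simp add: order_linear' del: mult_pCons_left)
  qed (simp add: order_0I)
  have spec: "spectrum A = set as"
    using eigenvalue_root_char_poly[OF A] unfolding spectrum_def cp
    by (auto simp: poly_prod_list prod_list_zero_iff)
  have "mat_energy A = (\<Sum>\<mu>\<in>set as. real (count_list as \<mu>) * cmod \<mu>)"
    unfolding mat_energy_def spec cp ord ..
  also have "\<dots> = (\<Sum>a\<leftarrow>as. cmod a)"
    using sum_list_count[of as "set as" cmod] by simp
  also have "\<dots> = (\<Sum>i<n. cmod (B $$ (i, i)))"
    using B by (simp add: as_def diag_mat_def sum_list_distinct_conv_sum_set atLeast0LessThan o_def)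
  finally show ?thesis .
qed

section \<open>Unitary triangularization and the energy bound\<close>

text \<open>Complete v to a basis, orthogonalise by Gram-Schmidt, which keeps the first vector, and
  normalise. With v an eigenvector this is the deflation step of
  \<open>unitary_schur\<close>.\<close>

lemma unitary_mat_first_col:
  fixes v :: "complex vec"
  assumes v: "v \<in> carrier_vec n" and v0: "v \<noteq> 0\<^sub>v n"
  obtains W c where "unitary_mat n W" "col W 0 = c \<cdot>\<^sub>v v"
proof -
  have n: "n \<noteq> 0"
    using v v0 by (metis eq_vecI carrier_vecD index_zero_vec(2) not_less_zero)
  interpret cof_vec_space n "TYPE(complex)" .
  define b where "b = basis_completion v"
  define ws where "ws = gram_schmidt n b"
  from basis_completion[OF v v0, folded b_def]
  have dist: "distinct b" and indep: "\<not> lin_dep (set b)" and b: "set b \<subseteq> carrier_vec n"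
    and hdb: "hd b = v" and len_b: "length b = n" by auto
  from hdb len_b n obtain vs where bv: "b = v # vs" by (cases b) auto
  from gram_schmidt_result[OF b dist indep refl, folded ws_def]
  have ws: "set ws \<subseteq> carrier_vec n" "corthogonal ws" "length ws = n"
    by (auto simp: len_b)
  have "hd ws = v"
    using gram_schmidt_hd[OF v, of vs, folded bv] by (simp add: ws_def)
  then have ws0: "ws ! 0 = v"
    using ws(3) n by (metis hd_conv_nth length_0_conv)
  have wsc: "ws ! j \<in> carrier_vec n" if "j < n" for j
    using ws that by auto
  \<comment> \<open>Gram-Schmidt here yields orthogonal vectors that are not normalised, so their
    norms are divided out in W. They are nonzero because \<open>corthogonal\<close> also says that
    no vector is orthogonal to itself.\<close>
  define r where "r j = sqrt (\<Sum>k<n. (cmod (ws ! j $ k))\<^sup>2)" for j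
  have sp: "(\<Sum>k<n. (ws ! j $ k) * cnj (ws ! i $ k)) = (if i = j then (complex_of_real (r j))\<^sup>2 else 0)"
    and rnz: "r j \<noteq> 0" if ij: "i < n" "j < n" for i j
  proof -
    have sp: "ws ! j \<bullet>c ws ! i = (\<Sum>k<n. (ws ! j $ k) * cnj (ws ! i $ k))" if "i < n" "j < n" for i j
      using wsc[OF that(1)] by (auto simp: scalar_prod_def atLeast0LessThan)
    have sq: "(\<Sum>k<n. (ws ! j $ k) * cnj (ws ! j $ k)) = (complex_of_real (r j))\<^sup>2"
    proof -
      have "(complex_of_real (r j))\<^sup>2 = complex_of_real ((r j)\<^sup>2)" by simp
      also have "(r j)\<^sup>2 = (\<Sum>k<n. (cmod (ws ! j $ k))\<^sup>2)"
        unfolding r_def by (simp add: sum_nonneg)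
      finally show ?thesis by (simp del: of_real_power add: complex_norm_square)
    qed
    show "(\<Sum>k<n. (ws ! j $ k) * cnj (ws ! i $ k)) = (if i = j then (complex_of_real (r j))\<^sup>2 else 0)"
      using sq sp[OF ij] corthogonalD[OF ws(2), of j i] ij ws(3) by auto
    show "r j \<noteq> 0"
      using sq sp[of j j] corthogonalD[OF ws(2), of j j] ij ws(3) by auto
  qed
  define W where "W = mat n n (\<lambda>(k, j). ws ! j $ k / complex_of_real (r j))"
  have Wc: "W \<in> carrier_mat n n" by (simp add: W_def)
  have "mat_adjoint W * W = 1\<^sub>m n"
  proof (rule eq_matI)
    fix i j assume "i < dim_row (1\<^sub>m n :: complex mat)" "j < dim_col (1\<^sub>m n :: complex mat)"
    then have ij: "i < n" "j < n" by auto
    have "(mat_adjoint W * W) $$ (i, j) = (\<Sum>k<n. mat_adjoint W $$ (i, k) * W $$ (k, j))"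
      using ij Wc by (intro index_mult_mat_sum[of _ n n _ n]) auto
    also have "\<dots> = (\<Sum>k<n. (ws ! j $ k) * cnj (ws ! i $ k)) / (complex_of_real (r i) * complex_of_real (r j))"
      unfolding sum_divide_distrib using ij Wc by (intro sum.cong) (auto simp: W_def)
    also have "\<dots> = 1\<^sub>m n $$ (i, j)"
      unfolding sp[OF ij] using ij rnz[OF ij] by (auto simp: power2_eq_square)
    finally show "(mat_adjoint W * W) $$ (i, j) = 1\<^sub>m n $$ (i, j)" .
  qed (use Wc in auto)
  then have "unitary_mat n W" using Wc by (simp add: unitary_mat_def)
  moreover have "col W 0 = (1 / complex_of_real (r 0)) \<cdot>\<^sub>v v"
    using n v by (intro eq_vecI) (auto simp: W_def ws0)
  ultimately show ?thesis by (rule that)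
qed

text \<open>Lets the unitary matrix from the induction hypothesis act on all coordinates but the
  first.\<close>

lemma unitary_mat_four_block:
  assumes U: "unitary_mat n U"
  shows "unitary_mat (Suc n) (four_block_mat (1\<^sub>m 1) (0\<^sub>m 1 n) (0\<^sub>m n 1) U)"
    and "mat_adjoint (four_block_mat (1\<^sub>m 1) (0\<^sub>m 1 n) (0\<^sub>m n 1) U)
      = four_block_mat (1\<^sub>m 1) (0\<^sub>m 1 n) (0\<^sub>m n 1) (mat_adjoint U)"
proof -
  have c: "U \<in> carrier_mat n n" "mat_adjoint U \<in> carrier_mat n n"
    using U by (simp_all add: unitary_mat_def)
  let ?D = "four_block_mat (1\<^sub>m 1) (0\<^sub>m 1 n) (0\<^sub>m n 1) U"
  show adj: "mat_adjoint ?D = four_block_mat (1\<^sub>m 1) (0\<^sub>m 1 n) (0\<^sub>m n 1) (mat_adjoint U)"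
    using c by (intro eq_matI) auto
  have "mat_adjoint ?D * ?D = four_block_mat (1\<^sub>m 1) (0\<^sub>m 1 n) (0\<^sub>m n 1) (1\<^sub>m n)"
    unfolding adj using c U
    by (subst mult_four_block_mat[of _ 1 1 _ n _ n _ _ 1 _ n]) (auto simp: unitary_mat_def)
  moreover have "?D \<in> carrier_mat (Suc n) (Suc n)"
    unfolding plus_1_eq_Suc[symmetric] by (rule four_block_carrier_mat[OF one_carrier_mat c(1)])
  ultimately show "unitary_mat (Suc n) ?D"
    by (simp add: unitary_mat_def)
qed

text \<open>Schur's theorem, by deflation: in an orthonormal basis that starts with an eigenvector,
  the first column vanishes below the corner, and the induction hypothesis treats the remaining
  diagonal block. The energy bound needs the change of basis to be unitary, not merely
  invertible.\<close>

theorem unitary_schur: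
  fixes A :: "complex mat"
  assumes "A \<in> carrier_mat n n"
  shows "\<exists>U. unitary_mat n U \<and> upper_triangular (mat_adjoint U * A * U)"
  using assms
proof (induction n arbitrary: A)
  case 0
  then show ?case
    by (intro exI[of _ "1\<^sub>m 0"]) (auto simp: unitary_mat_def upper_triangular_def)
next
  case (Suc n A)
  let ?N = "Suc n"
  obtain e where "eigenvalue A e"
    using spectrum_non_empty[OF Suc.prems] by (auto simp: spectrum_def)
  then obtain v where v: "v \<in> carrier_vec ?N" "v \<noteq> 0\<^sub>v ?N" and ev: "A *\<^sub>v v = e \<cdot>\<^sub>v v"
    using Suc.prems by (auto simp: eigenvalue_def eigenvector_def)
  obtain W c where W: "unitary_mat ?N W" and col: "col W 0 = c \<cdot>\<^sub>v v"
    using unitary_mat_first_col[OF v] .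
  have Wc: "W \<in> carrier_mat ?N ?N" "mat_adjoint W \<in> carrier_mat ?N ?N"
    using W by (simp_all add: unitary_mat_def)
  define A' where "A' = mat_adjoint W * A * W"
  have A'c: "A' \<in> carrier_mat ?N ?N"
    unfolding A'_def by (rule mult_carrier_mat[OF mult_carrier_mat[OF Wc(2) Suc.prems] Wc(1)])
  \<comment> \<open>The first column of W is an eigenvector for e, and the adjoint of W maps it to
    the first unit vector.\<close>
  have "col A' 0 = (mat_adjoint W * A) *\<^sub>v col W 0"
    unfolding A'_def by (rule col_mult2[OF mult_carrier_mat[OF Wc(2) Suc.prems] Wc(1)]) simp
  also have "\<dots> = mat_adjoint W *\<^sub>v (A *\<^sub>v (c \<cdot>\<^sub>v v))"
    unfolding col using Wc Suc.prems v by (intro assoc_mult_mat_vec) auto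
  also have "A *\<^sub>v (c \<cdot>\<^sub>v v) = e \<cdot>\<^sub>v col W 0"
    using Suc.prems v ev by (simp add: mult_mat_vec[of _ ?N ?N] col smult_smult_assoc mult.commute)
  also have "mat_adjoint W *\<^sub>v (e \<cdot>\<^sub>v col W 0) = e \<cdot>\<^sub>v (mat_adjoint W *\<^sub>v col W 0)"
    using Wc by (intro mult_mat_vec[of _ ?N ?N]) (auto intro: col_carrier_vec)
  also have "mat_adjoint W *\<^sub>v col W 0 = col (mat_adjoint W * W) 0"
    using Wc by (intro col_mult2[symmetric, of _ ?N ?N _ ?N]) auto
  also have "\<dots> = unit_vec ?N 0"
    using W by (simp add: unitary_mat_def)
  finally have col0: "col A' 0 = e \<cdot>\<^sub>v unit_vec ?N 0" .
  obtain A1 A2 A0 A3 where split: "split_block A' 1 1 = (A1, A2, A0, A3)"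
    by (cases "split_block A' 1 1") auto
  from split_block[OF split, of n n] A'c
  have blocks: "A1 \<in> carrier_mat 1 1" "A2 \<in> carrier_mat 1 n" "A0 \<in> carrier_mat n 1"
      "A3 \<in> carrier_mat n n" "A' = four_block_mat A1 A2 A0 A3"
    by auto
  have "A' $$ (Suc i, 0) = 0" if "i < n" for i
    using arg_cong[OF col0, of "\<lambda>w. w $ Suc i"] A'c that by simp
  then have A0: "A0 = 0\<^sub>m n 1"
    using split[unfolded split_block_def Let_def] A'c by auto
  obtain U3 where U3: "unitary_mat n U3" and ut: "upper_triangular (mat_adjoint U3 * A3 * U3)"
    using Suc.IH[OF blocks(4)] by blast
  have U3c: "U3 \<in> carrier_mat n n" "mat_adjoint U3 \<in> carrier_mat n n"
    using U3 by (simp_all add: unitary_mat_def)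
  define D where "D = four_block_mat (1\<^sub>m 1) (0\<^sub>m 1 n) (0\<^sub>m n 1) U3"
  have D: "unitary_mat ?N D"
    and adjD: "mat_adjoint D = four_block_mat (1\<^sub>m 1) (0\<^sub>m 1 n) (0\<^sub>m n 1) (mat_adjoint U3)"
    unfolding D_def using unitary_mat_four_block[OF U3] by blast+
  have Dc: "D \<in> carrier_mat ?N ?N" "mat_adjoint D \<in> carrier_mat ?N ?N"
    using D by (simp_all add: unitary_mat_def)
  \<comment> \<open>Conjugation by D keeps the corner A1 and the zero block below it, and makes A3
    triangular; A2 changes, but it lies above the diagonal.\<close>
  have "mat_adjoint D * A' = four_block_mat A1 A2 (0\<^sub>m n 1) (mat_adjoint U3 * A3)"
    unfolding adjD blocks(5) A0 using blocks(1-4) U3c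
    by (subst mult_four_block_mat[of _ 1 1 _ n _ n _ _ 1 _ n]) auto
  then have "mat_adjoint D * A' * D
      = four_block_mat A1 (A2 * U3) (0\<^sub>m n 1) (mat_adjoint U3 * A3 * U3)"
    using blocks(1-4) U3c
    by (simp only:, unfold D_def, subst mult_four_block_mat[of _ 1 1 _ n _ n _ _ 1 _ n]) auto
  moreover have "upper_triangular A1"
    using blocks(1) by (auto simp: upper_triangular_def)
  ultimately have "upper_triangular (mat_adjoint D * A' * D)"
    using upper_triangular_four_block[OF blocks(1) _ _ ut, of n] U3c blocks(4)
    by (simp only: mult_carrier_mat[OF mult_carrier_mat[OF U3c(2) blocks(4)] U3c(1)])
  moreover have "mat_adjoint D * A' * D = mat_adjoint (W * D) * A * (W * D)"
    unfolding A'_def mat_adjoint_mult[OF Wc(1) Dc(1)] using Wc Dc Suc.prems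
    by (simp add: assoc_mult_mat[of _ ?N ?N _ ?N _ ?N] mult_carrier_mat[of _ ?N ?N _ ?N])
  ultimately show ?case
    using unitary_mat_mult[OF W D] by auto
qed

text \<open>P and Q may be unrelated, so \<open>P * A * Q\<close> need not be similar to A; this is
  why two orthonormal bases, the columns of X and Y, appear. The proof bounds each diagonal entry of
  the triangular form by the triangle inequality and then collects the total weight of each entry of
  M.\<close>

lemma mat_energy_le_entrywise_l1_norm:
  assumes A: "A \<in> carrier_mat n n" and P: "unitary_mat n P" and Q: "unitary_mat n Q"
  shows "mat_energy A \<le> entrywise_l1_norm (P * A * Q)"
proof -
  obtain U where U: "unitary_mat n U" and ut: "upper_triangular (mat_adjoint U * A * U)"
    using unitary_schur[OF A] by blast
  define M X Y where "M = P * A * Q" and "X = P * U" and "Y = mat_adjoint Q * U"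
  have X: "unitary_mat n X" and Y: "unitary_mat n Y"
    unfolding X_def Y_def using P Q U by (auto intro: unitary_mat_mult unitary_mat_adjoint)
  have c: "U \<in> carrier_mat n n" "P \<in> carrier_mat n n" "Q \<in> carrier_mat n n" "X \<in> carrier_mat n n"
      "Y \<in> carrier_mat n n" "M \<in> carrier_mat n n"
    using P Q U X Y A by (auto simp: unitary_mat_def M_def)
  \<comment> \<open>X and Y are built so that P and Q cancel, which leaves the triangular form of
    A.\<close>
  have "mat_adjoint X * M * Y
      = mat_adjoint U * (mat_adjoint P * P) * A * (Q * mat_adjoint Q) * U"
    unfolding M_def X_def Y_def mat_adjoint_mult[OF c(2,1)] using c A
    by (simp add: assoc_mult_mat[of _ n n _ n _ n] mult_carrier_mat[of _ n n _ n])
  also have "\<dots> = mat_adjoint U * A * U"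
    using P c A unitary_mat_right[OF Q] by (simp add: unitary_mat_def)
  finally have T: "mat_adjoint U * A * U = mat_adjoint X * M * Y" ..
  have "similar_mat A (mat_adjoint U * A * U)"
  proof (rule similar_matI[of _ _ U "mat_adjoint U" n])
    have "U * (mat_adjoint U * A * U) * mat_adjoint U
        = (U * mat_adjoint U) * A * (U * mat_adjoint U)"
      using c A by (simp add: assoc_mult_mat[of _ n n _ n _ n] mult_carrier_mat[of _ n n _ n])
    then show "A = U * (mat_adjoint U * A * U) * mat_adjoint U"
      using A unitary_mat_right[OF U] by simp
  qed (use c A U unitary_mat_right[OF U] in \<open>auto simp: unitary_mat_def\<close>)
  then have "mat_energy A = (\<Sum>i<n. cmod ((mat_adjoint X * M * Y) $$ (i, i)))"
    using mat_energy_upper_triangular[OF _ A ut] T by simp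
  also have "\<dots> \<le> (\<Sum>i<n. \<Sum>l<n. \<Sum>k<n. cmod (M $$ (k, l)) * (((cmod (X $$ (k, i)))\<^sup>2 + (cmod (Y $$ (l, i)))\<^sup>2) / 2))"
  proof (rule sum_mono)
    fix i assume "i \<in> {..<n}"
    then have i: "i < n" by simp
    have "(mat_adjoint X * M * Y) $$ (i, i) = (\<Sum>l<n. (mat_adjoint X * M) $$ (i, l) * Y $$ (l, i))"
      using c i by (intro index_mult_mat_sum[of _ n n _ n]) (auto intro: mult_carrier_mat)
    also have "\<dots> = (\<Sum>l<n. \<Sum>k<n. cnj (X $$ (k, i)) * M $$ (k, l) * Y $$ (l, i))"
      unfolding sum_distrib_right[symmetric] using c i
      by (intro sum.cong refl arg_cong2[where f = "(*)"], subst index_mult_mat_sum[of _ n n _ n]) auto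
    finally have "cmod ((mat_adjoint X * M * Y) $$ (i, i))
        \<le> (\<Sum>l<n. \<Sum>k<n. cmod (cnj (X $$ (k, i)) * M $$ (k, l) * Y $$ (l, i)))"
      by (auto intro!: sum_norm_le order.trans[OF norm_sum] sum_mono)
    also have "\<dots> \<le> (\<Sum>l<n. \<Sum>k<n. cmod (M $$ (k, l)) * (((cmod (X $$ (k, i)))\<^sup>2 + (cmod (Y $$ (l, i)))\<^sup>2) / 2))"
    proof (intro sum_mono)
      fix l k
      \<comment> \<open>The arithmetic-geometric mean inequality leaves only squares, whose sums
        over i are row norms of X and Y.\<close>
      have "cmod (X $$ (k, i)) * cmod (Y $$ (l, i)) \<le> ((cmod (X $$ (k, i)))\<^sup>2 + (cmod (Y $$ (l, i)))\<^sup>2) / 2"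
        using sum_squares_bound[of "cmod (X $$ (k, i))" "cmod (Y $$ (l, i))"] by simp
      from mult_left_mono[OF this, of "cmod (M $$ (k, l))"]
      show "cmod (cnj (X $$ (k, i)) * M $$ (k, l) * Y $$ (l, i))
          \<le> cmod (M $$ (k, l)) * (((cmod (X $$ (k, i)))\<^sup>2 + (cmod (Y $$ (l, i)))\<^sup>2) / 2)"
        by (simp add: norm_mult mult_ac)
    qed
    finally show "cmod ((mat_adjoint X * M * Y) $$ (i, i))
        \<le> (\<Sum>l<n. \<Sum>k<n. cmod (M $$ (k, l)) * (((cmod (X $$ (k, i)))\<^sup>2 + (cmod (Y $$ (l, i)))\<^sup>2) / 2))" .
  qed
  \<comment> \<open>With i innermost, the weight of the entry of M at (k, l) becomes (1 + 1) / 2 =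
    1, since the rows of X and Y have norm 1.\<close>
  also have "\<dots> = (\<Sum>l<n. \<Sum>k<n. \<Sum>i<n. cmod (M $$ (k, l)) * (((cmod (X $$ (k, i)))\<^sup>2 + (cmod (Y $$ (l, i)))\<^sup>2) / 2))"
    by (subst sum.swap, rule sum.cong[OF refl], subst sum.swap, rule refl)
  also have "\<dots> = (\<Sum>l<n. \<Sum>k<n. cmod (M $$ (k, l)))"
    using unitary_mat_row_norm[OF X] unitary_mat_row_norm[OF Y]
    by (intro sum.cong refl)
       (simp add: sum_distrib_left[symmetric] sum_divide_distrib[symmetric] sum.distrib)
  also have "\<dots> = entrywise_l1_norm M"
    unfolding entrywise_l1_norm_def using c by (subst sum.swap) simp
  finally show ?thesis by (simp add: M_def)
qed

section \<open>Kronecker products\<close>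

lemma sum_bij_betw_prod:
  fixes f :: "'c \<Rightarrow> 'd::comm_monoid_add"
  assumes "bij_betw p (S \<times> T) U"
  shows "(\<Sum>z\<in>U. f z) = (\<Sum>a\<in>S. \<Sum>b\<in>T. f (p (a, b)))"
proof -
  have "(\<Sum>z\<in>U. f z) = (\<Sum>ab\<in>S \<times> T. f (p ab))"
    by (rule sum.reindex_bij_betw[OF assms, symmetric])
  also have "\<dots> = (\<Sum>a\<in>S. \<Sum>b\<in>T. f (p (a, b)))"
    by (simp add: sum.cartesian_product)
  finally show ?thesis .
qed

text \<open>The usual block layout: for B of size m, the pair (a, b) sits at index a m + b. It
  serves the energy, which any labeling computes; the Fourier ratio depends on the labeling and uses
  \<open>crt_index\<close>.\<close>

definition kron :: "complex mat \<Rightarrow> complex mat \<Rightarrow> complex mat" where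
  "kron A B = mat (dim_row A * dim_row B) (dim_col A * dim_col B)
     (\<lambda>(i, j). A $$ (i div dim_row B, j div dim_col B) * B $$ (i mod dim_row B, j mod dim_col B))"

lemma kron_carrier [simp]:
  assumes "A \<in> carrier_mat n n" "B \<in> carrier_mat m m"
  shows "kron A B \<in> carrier_mat (n * m) (n * m)"
  using assms unfolding kron_def carrier_mat_def by simp

lemma bij_betw_lex_index:
  "bij_betw (\<lambda>(a, b). a * m + b) ({..<n} \<times> {..<m}) {..<n * m :: nat}"
proof (rule bij_betwI[where g = "\<lambda>i. (i div m, i mod m)"])
  show "(\<lambda>(a, b). a * m + b) \<in> {..<n} \<times> {..<m} \<rightarrow> {..<n * m}"
  proof safe
    fix a b assume "a < n" "b < m"
    then have "a * m + b < Suc a * m" "Suc a * m \<le> n * m" by (simp, intro mult_le_mono1) auto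
    then show "a * m + b < n * m" by linarith
  qed
  \<comment> \<open>An index below n m can exist only if m is positive, so its remainder is below
    m.\<close>
  show "(\<lambda>i. (i div m, i mod m)) \<in> {..<n * m} \<rightarrow> {..<n} \<times> {..<m}"
    by (auto simp: less_mult_imp_div_less)
      (metis mod_less_divisor mult_0_right not_gr_zero not_less_zero)
qed auto

lemma kron_index_lex:
  assumes "A \<in> carrier_mat n n" "B \<in> carrier_mat m m" "a < n" "c < n" "b < m" "d < m"
  shows "kron A B $$ (a * m + b, c * m + d) = A $$ (a, c) * B $$ (b, d)"
proof -
  have "a * m + b < n * m" "c * m + d < n * m"
    using bij_betwE[OF bij_betw_lex_index[of m n]] assms by auto
  then show ?thesis using assms by (simp add: kron_def)
qed

lemma eq_mat_lexI:
  assumes "A \<in> carrier_mat (n * m) (n * m)" "B \<in> carrier_mat (n * m) (n * m)"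
    and "\<And>a b c d. \<lbrakk>a < n; b < m; c < n; d < m\<rbrakk>
      \<Longrightarrow> A $$ (a * m + b, c * m + d) = B $$ (a * m + b, c * m + d)"
  shows "A = B"
proof (rule eq_matI)
  fix i j assume "i < dim_row B" "j < dim_col B"
  then have "i < n * m" "j < n * m" using assms(2) by auto
  then have "i \<in> (\<lambda>(a, b). a * m + b) ` ({..<n} \<times> {..<m})"
      "j \<in> (\<lambda>(a, b). a * m + b) ` ({..<n} \<times> {..<m})"
    using bij_betw_imp_surj_on[OF bij_betw_lex_index[of m n]] by simp_all
  then show "A $$ (i, j) = B $$ (i, j)" using assms(3) by auto
qed (use assms in auto)

text \<open>The mixed-product rule: the summation index runs over pairs (x, y), and the double sum
  factors.\<close>

lemma kron_mult:
  assumes A: "A \<in> carrier_mat n n" and B: "B \<in> carrier_mat m m"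
    and C: "C \<in> carrier_mat n n" and D: "D \<in> carrier_mat m m"
  shows "kron A B * kron C D = kron (A * C) (B * D)"
proof (rule eq_mat_lexI[of _ n m])
  show AC: "kron A B * kron C D \<in> carrier_mat (n * m) (n * m)"
    by (rule mult_carrier_mat[OF kron_carrier[OF A B] kron_carrier[OF C D]])
  show "kron (A * C) (B * D) \<in> carrier_mat (n * m) (n * m)"
    by (rule kron_carrier[OF mult_carrier_mat[OF A C] mult_carrier_mat[OF B D]])
  fix a b c d assume *: "a < n" "b < m" "c < n" "d < m"
  then have lt: "a * m + b < n * m" "c * m + d < n * m"
    using bij_betwE[OF bij_betw_lex_index[of m n]] by auto
  have "(kron A B * kron C D) $$ (a * m + b, c * m + d)
      = (\<Sum>z<n * m. kron A B $$ (a * m + b, z) * kron C D $$ (z, c * m + d))"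
    by (rule index_mult_mat_sum[OF kron_carrier[OF A B] kron_carrier[OF C D] lt])
  also have "\<dots> = (\<Sum>x<n. \<Sum>y<m. kron A B $$ (a * m + b, x * m + y) * kron C D $$ (x * m + y, c * m + d))"
    by (subst sum_bij_betw_prod[OF bij_betw_lex_index]) simp
  also have "\<dots> = (\<Sum>x<n. \<Sum>y<m. (A $$ (a, x) * C $$ (x, c)) * (B $$ (b, y) * D $$ (y, d)))"
    using * by (intro sum.cong refl) (simp add: kron_index_lex[OF A B] kron_index_lex[OF C D])
  also have "\<dots> = (A * C) $$ (a, c) * (B * D) $$ (b, d)"
    unfolding index_mult_mat_sum[OF A C *(1,3)] index_mult_mat_sum[OF B D *(2,4)] by (simp add: sum_product)
  also have "\<dots> = kron (A * C) (B * D) $$ (a * m + b, c * m + d)"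
    by (rule kron_index_lex[symmetric, OF mult_carrier_mat[OF A C] mult_carrier_mat[OF B D] *(1,3,2,4)])
  finally show "(kron A B * kron C D) $$ (a * m + b, c * m + d)
      = kron (A * C) (B * D) $$ (a * m + b, c * m + d)" .
qed

lemma kron_one: "kron (1\<^sub>m n) (1\<^sub>m m) = 1\<^sub>m (n * m)"
proof (rule eq_mat_lexI[of _ n m])
  fix a b c d assume *: "a < n" "b < m" "c < n" "d < m"
  then have lt: "a * m + b < n * m" "c * m + d < n * m"
    using bij_betwE[OF bij_betw_lex_index[of m n]] by auto
  have "a * m + b = c * m + d \<longleftrightarrow> a = c \<and> b = d"
    using inj_onD[OF bij_betw_imp_inj_on[OF bij_betw_lex_index[of m n]], of "(a, b)" "(c, d)"] *
    by auto
  then show "kron (1\<^sub>m n) (1\<^sub>m m) $$ (a * m + b, c * m + d) = 1\<^sub>m (n * m) $$ (a * m + b, c * m + d)"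
    using * lt by (simp add: kron_index_lex[of _ n _ m])
qed simp_all

text \<open>The Kronecker products of the two pairs of witnesses are witnesses, by the mixed-product
  rule.\<close>

lemma similar_mat_kron:
  assumes "similar_mat A B" "similar_mat C D" and A: "A \<in> carrier_mat n n" and C: "C \<in> carrier_mat m m"
  shows "similar_mat (kron A C) (kron B D)"
proof -
  obtain P Q where "similar_mat_wit A B P Q" using assms(1) by (auto simp: similar_mat_def)
  note 1 = similar_mat_witD2[OF A this]
  obtain R S where "similar_mat_wit C D R S" using assms(2) by (auto simp: similar_mat_def)
  note 2 = similar_mat_witD2[OF C this]
  show ?thesis
  proof (rule similar_matI[of _ _ "kron P R" "kron Q S" "n * m"])
    show "kron P R * kron Q S = 1\<^sub>m (n * m)" "kron Q S * kron P R = 1\<^sub>m (n * m)"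
      using kron_mult[OF 1(6) 2(6) 1(7) 2(7)] kron_mult[OF 1(7) 2(7) 1(6) 2(6)] 1(1,2) 2(1,2)
      by (simp_all add: kron_one)
    show "kron A C = kron P R * kron B D * kron Q S"
      by (simp only: kron_mult[OF 1(6) 2(6) 1(5) 2(5)]
        kron_mult[OF mult_carrier_mat[OF 1(6,5)] mult_carrier_mat[OF 2(6,5)] 1(7) 2(7)] 1(3)[symmetric] 2(3)[symmetric])
  qed (use 1(4-7) 2(4-7) in auto)
qed

text \<open>The Kronecker product of two triangular forms is triangular, and its diagonal consists
  of all products of their diagonal entries. Only similarity matters here, so any triangularization
  will do.\<close>

lemma mat_energy_kron:
  assumes A: "A \<in> carrier_mat n n" and B: "B \<in> carrier_mat m m"
  shows "mat_energy (kron A B) = mat_energy A * mat_energy B"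
proof -
  obtain as bs where cp: "char_poly A = (\<Prod>a\<leftarrow>as. [:- a, 1:])" "char_poly B = (\<Prod>b\<leftarrow>bs. [:- b, 1:])"
    using char_poly_factorized[OF A] char_poly_factorized[OF B] by blast
  obtain T where T: "T \<in> carrier_mat n n" "upper_triangular T" "similar_mat A T"
    using schur_decomposition_exists[OF A cp(1)] by blast
  obtain R where R: "R \<in> carrier_mat m m" "upper_triangular R" "similar_mat B R"
    using schur_decomposition_exists[OF B cp(2)] by blast
  have ut: "upper_triangular (kron T R)"
    unfolding upper_triangular_def
  proof (intro allI impI)
    fix i j assume "i < dim_row (kron T R)" and ji: "j < i"
    then have i: "i < n * m" using T R by (simp add: kron_def)
    have mpos: "m > 0" using i by (cases m) auto
    \<comment> \<open>Numeric order of indices is lexicographic order of pairs, so below the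
      diagonal one of the two factors is a subdiagonal entry of T or R.\<close>
    have "j div m < i div m \<or> j div m = i div m \<and> j mod m < i mod m"
      using ji by (metis div_le_mono div_mult_mod_eq le_neq_implies_less less_imp_le_nat nat_add_left_cancel_less)
    then show "kron T R $$ (i, j) = 0"
    proof
      assume "j div m < i div m"
      moreover have "i div m < n" using i by (simp add: less_mult_imp_div_less)
      ultimately show ?thesis
        using T R i ji by (auto simp: kron_def upper_triangular_def)
    next
      assume "j div m = i div m \<and> j mod m < i mod m"
      moreover have "i mod m < m" using mpos by simp
      ultimately show ?thesis
        using T R i ji by (auto simp: kron_def upper_triangular_def)
    qed
  qed
  have "mat_energy (kron A B) = (\<Sum>i<n * m. cmod (kron T R $$ (i, i)))"
    by (rule mat_energy_upper_triangular[OF similar_mat_kron[OF T(3) R(3) A B] kron_carrier[OF A B] ut])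
  also have "\<dots> = (\<Sum>a<n. \<Sum>b<m. cmod (T $$ (a, a)) * cmod (R $$ (b, b)))"
    by (subst sum_bij_betw_prod[OF bij_betw_lex_index])
       (auto intro!: sum.cong simp: kron_index_lex[OF T(1) R(1)] norm_mult)
  also have "\<dots> = mat_energy A * mat_energy B"
    unfolding mat_energy_upper_triangular[OF T(3) A T(2)] mat_energy_upper_triangular[OF R(3) B R(2)]
    by (simp add: sum_product)
  finally show ?thesis .
qed

section \<open>The Fourier matrix and the Chinese remainder theorem\<close>

text \<open>The additive character of the integers modulo N behind \<open>fourier_mat\<close>. Its
  argument is any natural number; \<open>fourier_char_cong\<close> says that only the residue
  matters.\<close>

definition fourier_char :: "nat \<Rightarrow> nat \<Rightarrow> complex" where
  "fourier_char N t = cis (- (2 * pi * real t / real N))"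

lemma fourier_char_add: "fourier_char N (s + t) = fourier_char N s * fourier_char N t"
  by (simp add: fourier_char_def cis_mult add_divide_distrib algebra_simps)

lemma fourier_char_mod: "fourier_char N (t mod N) = fourier_char N t"
proof (cases "N = 0")
  case False
  have "fourier_char N (N * q) = 1" for q
    using cis_multiple_2pi[of "- real q"] False by (simp add: fourier_char_def mult.assoc)
  then have "fourier_char N (N * (t div N) + t mod N) = fourier_char N (t mod N)"
    by (simp only: fourier_char_add mult_1_left)
  then show ?thesis by simp
qed simp

lemma fourier_char_cong: "[s = t] (mod N) \<Longrightarrow> fourier_char N s = fourier_char N t"
  by (metis cong_def fourier_char_mod)

lemma fourier_char_mult_cancel:
  "m > 0 \<Longrightarrow> fourier_char (n * m) (t * m) = fourier_char n t"
  by (simp add: fourier_char_def mult.assoc)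

lemma fourier_char_power: "fourier_char N (k * t) = fourier_char N t ^ k"
  by (simp add: fourier_char_def DeMoivre algebra_simps)

lemma fourier_mat_carrier [simp]: "fourier_mat N \<in> carrier_mat N N"
  by (simp add: fourier_mat_def)

lemma fourier_mat_index:
  assumes "k < N" "x < N"
  shows "fourier_mat N $$ (k, x) = fourier_char N (k * x) / complex_of_real (sqrt (real N))"
proof -
  have "exp (- 2 * complex_of_real pi * \<i> * of_nat k * of_nat x / of_nat N) = fourier_char N (k * x)"
    unfolding fourier_char_def cis_conv_exp by (rule arg_cong[of _ _ exp]) (simp add: algebra_simps)
  then show ?thesis using assms by (simp add: fourier_mat_def)
qed

text \<open>The inner product of columns i and j is a geometric sum over the powers of an N-th root
  of unity w. It vanishes unless w = 1.\<close>

lemma unitary_fourier_mat: "unitary_mat N (fourier_mat N)"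
proof -
  have "mat_adjoint (fourier_mat N) * fourier_mat N = 1\<^sub>m N"
  proof (rule eq_matI)
    fix i j assume "i < dim_row (1\<^sub>m N :: complex mat)" "j < dim_col (1\<^sub>m N :: complex mat)"
    then have ij: "i < N" "j < N" by auto
    then have N: "N > 0" by simp
    define w where "w = cnj (fourier_char N i) * fourier_char N j"
    have w: "w = cis (2 * pi * real i / real N) / cis (2 * pi * real j / real N)"
      by (simp add: w_def fourier_char_def cis_cnj cis_divide cis_mult)
    have "(mat_adjoint (fourier_mat N) * fourier_mat N) $$ (i, j)
        = (\<Sum>k<N. mat_adjoint (fourier_mat N) $$ (i, k) * fourier_mat N $$ (k, j))"
      using ij by (intro index_mult_mat_sum[of _ N N _ N]) auto
    also have "\<dots> = (\<Sum>k<N. w ^ k / of_nat N)"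
    proof (rule sum.cong[OF refl])
      fix k assume "k \<in> {..<N}"
      then have k: "k < N" by simp
      have "complex_of_real (sqrt (real N)) * complex_of_real (sqrt (real N)) = of_nat N"
        by (simp flip: of_real_mult)
      moreover have "mat_adjoint (fourier_mat N) $$ (i, k) = cnj (fourier_mat N $$ (k, i))"
        using ij k by (subst mat_adjoint_index) (auto simp: fourier_mat_def)
      ultimately show "mat_adjoint (fourier_mat N) $$ (i, k) * fourier_mat N $$ (k, j) = w ^ k / of_nat N"
        using ij k by (simp add: fourier_mat_index w_def fourier_char_power power_mult_distrib)
    qed
    also have "\<dots> = (if i = j then 1 else 0)"
    proof (cases "i = j")
      case True
      then have "w = 1" unfolding w by simp
      then show ?thesis using N True by simp
    next
      case False
      have bij: "bij_betw (\<lambda>k. cis (2 * pi * real k / real N)) {..<N} {z. z ^ N = 1}"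
        by (rule bij_betw_roots_unity[OF N])
      \<comment> \<open>w is the quotient of the roots of unity numbered i and j, which are
        distinct.\<close>
      have "w \<noteq> 1"
        using bij_betw_imp_inj_on[OF bij] ij False unfolding w by (auto dest: inj_onD)
      moreover have "w ^ N = 1"
        using bij_betwE[OF bij] ij unfolding w power_divide by simp
      ultimately show ?thesis
        using False by (simp add: sum_divide_distrib[symmetric] geometric_sum)
    qed
    also have "\<dots> = 1\<^sub>m N $$ (i, j)" using ij by simp
    finally show "(mat_adjoint (fourier_mat N) * fourier_mat N) $$ (i, j) = 1\<^sub>m N $$ (i, j)" .
  qed (simp_all add: fourier_mat_def)
  then show ?thesis by (simp add: unitary_mat_def)
qed

text \<open>Chosen so that the index divided by n m is a / n + b / m modulo 1, which splits the
  character. This is not the inverse of taking residues: the index is a m modulo n and b n modulo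
  m.\<close>

definition crt_index :: "nat \<Rightarrow> nat \<Rightarrow> nat \<times> nat \<Rightarrow> nat" where
  "crt_index n m = (\<lambda>(a, b). (a * m + b * n) mod (n * m))"

text \<open>The Chinese remainder theorem: numbers congruent modulo both coprime factors are
  congruent modulo the product, and counting gives surjectivity. This map indexes frequencies, while
  \<open>crt_index\<close> indexes positions.\<close>

lemma bij_betw_residues:
  assumes "coprime n m" "n > 0" "m > 0"
  shows "bij_betw (\<lambda>k. (k mod n, k mod m)) {..<n * m :: nat} ({..<n} \<times> {..<m})"
proof (rule bij_betw_imageI)
  show inj: "inj_on (\<lambda>k. (k mod n, k mod m)) {..<n * m}"
  proof (rule inj_onI)
    fix k l assume "k \<in> {..<n * m}" "l \<in> {..<n * m}" "(k mod n, k mod m) = (l mod n, l mod m)"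
    then show "k = l"
      using coprime_cong_mult_nat[of k l n m] assms(1) by (auto simp: cong_def)
  qed
  show "(\<lambda>k. (k mod n, k mod m)) ` {..<n * m} = {..<n} \<times> {..<m}"
    using assms by (intro card_subset_eq) (auto simp: card_image[OF inj])
qed

text \<open>Modulo n only a m survives, and m can be cancelled by coprimality; symmetrically for b
  modulo m. Counting gives surjectivity.\<close>

lemma bij_betw_crt_index:
  assumes "coprime n m" "n > 0" "m > 0"
  shows "bij_betw (crt_index n m) ({..<n} \<times> {..<m}) {..<n * m}"
proof (rule bij_betw_imageI)
  show inj: "inj_on (crt_index n m) ({..<n} \<times> {..<m})"
  proof (rule inj_onI, safe)
    fix a b c d assume *: "a < n" "b < m" "c < n" "d < m"
      and "crt_index n m (a, b) = crt_index n m (c, d)"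
    then have eq: "[a * m + b * n = c * m + d * n] (mod (n * m))"
      by (simp add: crt_index_def cong_def)
    have "[a * m + b * n = c * m + d * n] (mod n)"
      using eq by (rule cong_dvd_modulus_nat) simp
    then have "[a * m = c * m] (mod n)" by (simp add: cong_def)
    then show "a = c"
      using assms(1) * by (simp add: cong_mult_rcancel_nat coprime_commute cong_less_modulus_unique_nat)
    have "[a * m + b * n = c * m + d * n] (mod m)"
      using eq by (rule cong_dvd_modulus_nat) simp
    then have "[b * n = d * n] (mod m)" by (simp add: cong_def)
    then show "b = d"
      using assms(1) * by (simp add: cong_mult_rcancel_nat coprime_commute cong_less_modulus_unique_nat)
  qed
  show "crt_index n m ` ({..<n} \<times> {..<m}) = {..<n * m}"
  proof (rule card_subset_eq)
    show "crt_index n m ` ({..<n} \<times> {..<m}) \<subseteq> {..<n * m}"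
      using assms(2,3) by (auto simp: crt_index_def)
  qed (simp_all add: card_image[OF inj])
qed

text \<open>Both index orders are stated because F stands on either side of the adjacency matrix;
  they agree since F is symmetric.\<close>

lemma fourier_mat_crt_index:
  assumes "coprime n m" "n > 0" "m > 0" "k < n * m" "a < n" "b < m"
  shows "fourier_mat (n * m) $$ (k, crt_index n m (a, b))
      = fourier_mat n $$ (k mod n, a) * fourier_mat m $$ (k mod m, b)"
    and "fourier_mat (n * m) $$ (crt_index n m (a, b), k)
      = fourier_mat n $$ (a, k mod n) * fourier_mat m $$ (b, k mod m)"
proof -
  let ?z = "crt_index n m (a, b)"
  have z: "?z < n * m"
    using bij_betwE[OF bij_betw_crt_index[OF assms(1-3)]] assms by auto
  \<comment> \<open>The reduction modulo n m inside \<open>crt_index\<close> is invisible to the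
    character.\<close>
  have "fourier_char (n * m) (k * ?z) = fourier_char (n * m) (k * a * m + k * b * n)"
    by (rule fourier_char_cong) (simp add: crt_index_def cong_def mod_mult_right_eq algebra_simps)
  also have "\<dots> = fourier_char n (k * a) * fourier_char m (k * b)"
    using fourier_char_mult_cancel[of m n "k * a"] fourier_char_mult_cancel[of n m "k * b"] assms
    by (simp add: fourier_char_add mult.commute[of n m])
  also have "fourier_char n (k * a) = fourier_char n (k mod n * a)"
    by (rule fourier_char_cong) (simp add: cong_def mod_mult_left_eq)
  also have "fourier_char m (k * b) = fourier_char m (k mod m * b)"
    by (rule fourier_char_cong) (simp add: cong_def mod_mult_left_eq)
  finally have *: "fourier_char (n * m) (k * ?z) = fourier_char n (k mod n * a) * fourier_char m (k mod m * b)" .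
  show "fourier_mat (n * m) $$ (k, ?z) = fourier_mat n $$ (k mod n, a) * fourier_mat m $$ (k mod m, b)"
    using assms z by (simp add: fourier_mat_index * real_sqrt_mult)
  show "fourier_mat (n * m) $$ (?z, k) = fourier_mat n $$ (a, k mod n) * fourier_mat m $$ (b, k mod m)"
    using assms z * by (simp add: fourier_mat_index real_sqrt_mult mult.commute)
qed

lemma index_mult3_mat_sum:
  assumes A: "A \<in> carrier_mat n n" and B: "B \<in> carrier_mat n n" and C: "C \<in> carrier_mat n n"
    and "i < n" "j < n"
  shows "(A * B * C) $$ (i, j) = (\<Sum>w<n. \<Sum>z<n. A $$ (i, z) * B $$ (z, w) * C $$ (w, j))"
  unfolding index_mult_mat_sum[OF mult_carrier_mat[OF A B] C assms(4,5)]
  using index_mult_mat_sum[OF A B assms(4)] by (intro sum.cong) (auto simp: sum_distrib_right)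

text \<open>Positions are summed through \<open>crt_index\<close>, so each entry of the transform of
  C is a product of entries of the transforms of A and B at the residues of the frequencies. Those
  residues run bijectively over all pairs, so both norms factor.\<close>

lemma fourier_ratio_crt_product:
  assumes cop: "coprime n m" and pos: "n > 0" "m > 0"
    and A: "A \<in> carrier_mat n n" and B: "B \<in> carrier_mat m m" and C: "C \<in> carrier_mat (n * m) (n * m)"
    and prod: "\<And>a b c d. \<lbrakk>a < n; b < m; c < n; d < m\<rbrakk>
      \<Longrightarrow> C $$ (crt_index n m (a, b), crt_index n m (c, d)) = A $$ (a, c) * B $$ (b, d)"
  shows "fourier_ratio C = fourier_ratio A * fourier_ratio B"
proof -
  define MA MB MC where "MA = fourier_mat n * A * fourier_mat n"
    and "MB = fourier_mat m * B * fourier_mat m"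
    and "MC = fourier_mat (n * m) * C * fourier_mat (n * m)"
  have c: "MA \<in> carrier_mat n n" "MB \<in> carrier_mat m m" "MC \<in> carrier_mat (n * m) (n * m)"
    unfolding MA_def MB_def MC_def using A B C
    by (meson fourier_mat_carrier mult_carrier_mat)+
  note bij = bij_betw_crt_index[OF cop pos]
  have MC: "MC $$ (k, l) = MA $$ (k mod n, l mod n) * MB $$ (k mod m, l mod m)"
    if kl: "k < n * m" "l < n * m" for k l
  proof -
    let ?fa = "\<lambda>x a. fourier_mat n $$ (k mod n, a) * A $$ (a, x) * fourier_mat n $$ (x, l mod n)"
    let ?fb = "\<lambda>y b. fourier_mat m $$ (k mod m, b) * B $$ (b, y) * fourier_mat m $$ (y, l mod m)"
    have "MC $$ (k, l) = (\<Sum>w<n * m. \<Sum>z<n * m. fourier_mat (n * m) $$ (k, z) * C $$ (z, w)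
        * fourier_mat (n * m) $$ (w, l))"
      unfolding MC_def by (rule index_mult3_mat_sum[OF fourier_mat_carrier C fourier_mat_carrier kl])
    also have "\<dots> = (\<Sum>x<n. \<Sum>y<m. \<Sum>a<n. \<Sum>b<m. ?fa x a * ?fb y b)"
      unfolding sum_bij_betw_prod[OF bij]
      by (intro sum.cong refl) (simp add: fourier_mat_crt_index[OF cop pos] kl prod)
    also have "\<dots> = (\<Sum>x<n. \<Sum>a<n. ?fa x a) * (\<Sum>y<m. \<Sum>b<m. ?fb y b)"
      unfolding sum_product ..
    also have "\<dots> = MA $$ (k mod n, l mod n) * MB $$ (k mod m, l mod m)"
      unfolding MA_def MB_def using pos
      by (simp add: index_mult3_mat_sum[OF fourier_mat_carrier A fourier_mat_carrier]
        index_mult3_mat_sum[OF fourier_mat_carrier B fourier_mat_carrier] del: index_mult_mat(1))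
    finally show ?thesis .
  qed
  \<comment> \<open>Used with f the modulus and its square; both are multiplicative, which gives the
    summand this shape.\<close>
  have sums: "(\<Sum>k<n * m. \<Sum>l<n * m. f (MA $$ (k mod n, l mod n)) * f (MB $$ (k mod m, l mod m)))
      = (\<Sum>a<n. \<Sum>x<n. f (MA $$ (a, x))) * (\<Sum>b<m. \<Sum>y<m. f (MB $$ (b, y)))"
    for f :: "complex \<Rightarrow> real"
  proof -
    have re: "(\<Sum>k<n * m. h (k mod n) (k mod m)) = (\<Sum>a<n. \<Sum>b<m. h a b)"
      for h :: "nat \<Rightarrow> nat \<Rightarrow> real"
      using sum.reindex_bij_betw[OF bij_betw_residues[OF cop pos], of "\<lambda>(a, b). h a b"]
      by (simp add: sum.cartesian_product)
    have "(\<Sum>k<n * m. \<Sum>l<n * m. f (MA $$ (k mod n, l mod n)) * f (MB $$ (k mod m, l mod m)))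
        = (\<Sum>k<n * m. \<Sum>x<n. \<Sum>y<m. f (MA $$ (k mod n, x)) * f (MB $$ (k mod m, y)))"
      by (intro sum.cong refl re)
    also have "\<dots> = (\<Sum>a<n. \<Sum>b<m. \<Sum>x<n. \<Sum>y<m. f (MA $$ (a, x)) * f (MB $$ (b, y)))"
      by (rule re)
    finally show ?thesis unfolding sum_product .
  qed
  have "entrywise_l1_norm MC = entrywise_l1_norm MA * entrywise_l1_norm MB"
    using c sums[of cmod] by (simp add: entrywise_l1_norm_def MC norm_mult)
  moreover have "frobenius_norm MC = frobenius_norm MA * frobenius_norm MB"
    using c sums[of "\<lambda>z. (cmod z)\<^sup>2"]
    by (simp add: frobenius_norm_def MC norm_mult power_mult_distrib real_sqrt_mult)
  ultimately show ?thesis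
    using A B C by (simp add: fourier_ratio_def Let_def MA_def MB_def MC_def)
qed

section \<open>Weak products of graphs\<close>

lemma card_weak_product_pverts: "card (pverts (G \<times>\<^sub>w H)) = card (pverts G) * card (pverts H)"
  by (simp add: weak_product_def card_cartesian_product)

text \<open>The pairing p is left open so that the lexicographic one can serve the energy and
  \<open>crt_index\<close> the Fourier ratio.\<close>

lemma weak_product_labeling:
  assumes \<sigma>: "\<sigma> \<in> vertex_labelings G" and \<tau>: "\<tau> \<in> vertex_labelings H"
    and p: "bij_betw p ({..<card (pverts G)} \<times> {..<card (pverts H)}) {..<card (pverts G) * card (pverts H)}"
  obtains \<rho> where "\<rho> \<in> vertex_labelings (G \<times>\<^sub>w H)"
    and "\<And>a b c d. \<lbrakk>a < card (pverts G); b < card (pverts H); c < card (pverts G); d < card (pverts H)\<rbrakk>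
      \<Longrightarrow> adj_mat (G \<times>\<^sub>w H) \<rho> $$ (p (a, b), p (c, d)) = adj_mat G \<sigma> $$ (a, c) * adj_mat H \<tau> $$ (b, d)"
proof -
  define V W n m where "V = pverts G" and "W = pverts H" and "n = card V" and "m = card W"
  have bs: "bij_betw \<sigma> V {..<n}" and bt: "bij_betw \<tau> W {..<m}"
    using \<sigma> \<tau> by (simp_all add: vertex_labelings_def V_def W_def n_def m_def)
  have p: "bij_betw p ({..<n} \<times> {..<m}) {..<n * m}"
    using p by (simp add: V_def W_def n_def m_def)
  have VW: "pverts (G \<times>\<^sub>w H) = V \<times> W"
    by (simp add: weak_product_def V_def W_def)
  have cVW: "card (V \<times> W) = n * m" by (simp add: n_def m_def card_cartesian_product)
  \<comment> \<open>The restriction makes the combined labeling extensional, as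
    \<open>vertex_labelings\<close> demands.\<close>
  define \<rho> where "\<rho> = restrict (\<lambda>v. p (map_prod \<sigma> \<tau> v)) (V \<times> W)"
  have bij: "bij_betw \<rho> (V \<times> W) {..<n * m}"
    unfolding \<rho>_def bij_betw_restrict_eq
    using bij_betw_trans[OF bij_betw_map_prod[OF bs bt] p] by (simp add: comp_def)
  have "\<rho> \<in> vertex_labelings (G \<times>\<^sub>w H)"
    using bij by (simp add: vertex_labelings_def VW cVW) (simp add: \<rho>_def)
  moreover have inv: "inv_into (V \<times> W) \<rho> (p (a, b)) = (inv_into V \<sigma> a, inv_into W \<tau> b)"
    if "a < n" "b < m" for a b
  proof -
    have "inv_into V \<sigma> a \<in> V" "inv_into W \<tau> b \<in> W"
      using bij_betwE[OF bij_betw_inv_into[OF bs]] bij_betwE[OF bij_betw_inv_into[OF bt]] that by auto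
    moreover have "\<sigma> (inv_into V \<sigma> a) = a" "\<tau> (inv_into W \<tau> b) = b"
      using bij_betw_inv_into_right[OF bs] bij_betw_inv_into_right[OF bt] that by auto
    ultimately show ?thesis
      using bij_betw_imp_inj_on[OF bij] by (intro inv_into_f_eq) (auto simp: \<rho>_def)
  qed
  have "adj_mat (G \<times>\<^sub>w H) \<rho> $$ (p (a, b), p (c, d)) = adj_mat G \<sigma> $$ (a, c) * adj_mat H \<tau> $$ (b, d)"
    if "a < n" "b < m" "c < n" "d < m" for a b c d
  proof -
    have "p (a, b) < n * m" "p (c, d) < n * m"
      using bij_betwE[OF p] that by auto
    then have "adj_mat (G \<times>\<^sub>w H) \<rho> $$ (p (a, b), p (c, d))
        = (if ((inv_into V \<sigma> a, inv_into W \<tau> b), (inv_into V \<sigma> c, inv_into W \<tau> d)) \<in> parcs (G \<times>\<^sub>w H)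
           then 1 else 0)"
      using that by (simp add: adj_mat_def VW cVW inv)
    then show ?thesis
      using that by (simp add: weak_product_def adj_mat_def V_def W_def n_def m_def)
  qed
  ultimately show ?thesis
    using that[of \<rho>] by (simp add: V_def W_def n_def m_def)
qed

lemma adj_mat_carrier: "adj_mat G \<sigma> \<in> carrier_mat (card (pverts G)) (card (pverts G))"
  by (simp add: adj_mat_def)

text \<open>Under the lexicographic labeling the adjacency matrix of the product is a Kronecker
  product, and the energy may be computed from any labeling.\<close>

lemma graph_energy_weak_product:
  assumes "finite (pverts G)" "finite (pverts H)"
  shows "graph_energy (G \<times>\<^sub>w H) = graph_energy G * graph_energy H"
proof -
  obtain \<sigma> \<tau> where \<sigma>: "\<sigma> \<in> vertex_labelings G" and \<tau>: "\<tau> \<in> vertex_labelings H"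
    using vertex_labelings_nonempty[OF assms(1)] vertex_labelings_nonempty[OF assms(2)] by blast
  obtain \<rho> where \<rho>: "\<rho> \<in> vertex_labelings (G \<times>\<^sub>w H)"
    and entry: "\<And>a b c d. \<lbrakk>a < card (pverts G); b < card (pverts H); c < card (pverts G); d < card (pverts H)\<rbrakk>
      \<Longrightarrow> adj_mat (G \<times>\<^sub>w H) \<rho> $$ (a * card (pverts H) + b, c * card (pverts H) + d)
        = adj_mat G \<sigma> $$ (a, c) * adj_mat H \<tau> $$ (b, d)"
    using weak_product_labeling[OF \<sigma> \<tau> bij_betw_lex_index] by auto
  note c = adj_mat_carrier[of G \<sigma>] adj_mat_carrier[of H \<tau>]
  have "adj_mat (G \<times>\<^sub>w H) \<rho> = kron (adj_mat G \<sigma>) (adj_mat H \<tau>)"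
    using adj_mat_carrier[of "G \<times>\<^sub>w H" \<rho>] kron_carrier[OF c]
    by (intro eq_mat_lexI) (auto simp: card_weak_product_pverts kron_index_lex[OF c] entry)
  then show ?thesis
    by (simp add: graph_energy_eq[OF \<sigma>] graph_energy_eq[OF \<tau>] graph_energy_eq[OF \<rho>] mat_energy_kron[OF c])
qed

section \<open>Upper bound for the edge complexity of a product\<close>

lemma edge_complexity_le:
  assumes "finite (pverts G)" "\<sigma> \<in> vertex_labelings G"
  shows "edge_complexity G \<le> fourier_ratio (adj_mat G \<sigma>)"
  unfolding edge_complexity_def using assms finite_vertex_labelings by (intro Min_le) auto

lemma edge_complexity_attained:
  assumes "finite (pverts G)"
  obtains \<sigma> where "\<sigma> \<in> vertex_labelings G" "edge_complexity G = fourier_ratio (adj_mat G \<sigma>)"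
proof -
  have "edge_complexity G \<in> (\<lambda>\<sigma>. fourier_ratio (adj_mat G \<sigma>)) ` vertex_labelings G"
    unfolding edge_complexity_def
    using assms finite_vertex_labelings vertex_labelings_nonempty by (intro Min_in) auto
  then show ?thesis using that by blast
qed

text \<open>Optimal labelings of G and H, combined by \<open>crt_index\<close>, give a competitor in
  the minimum for the product whose Fourier ratio is exactly the product of the two minima.\<close>

lemma edge_complexity_weak_product_le:
  assumes fin: "finite (pverts G)" "finite (pverts H)" and ne: "pverts G \<noteq> {}" "pverts H \<noteq> {}"
    and cop: "coprime (card (pverts G)) (card (pverts H))"
  shows "edge_complexity (G \<times>\<^sub>w H) \<le> edge_complexity G * edge_complexity H"
proof -
  obtain \<sigma> where \<sigma>: "\<sigma> \<in> vertex_labelings G" "edge_complexity G = fourier_ratio (adj_mat G \<sigma>)"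
    using edge_complexity_attained[OF fin(1)] .
  obtain \<tau> where \<tau>: "\<tau> \<in> vertex_labelings H" "edge_complexity H = fourier_ratio (adj_mat H \<tau>)"
    using edge_complexity_attained[OF fin(2)] .
  have pos: "card (pverts G) > 0" "card (pverts H) > 0"
    using fin ne by (simp_all add: card_gt_0_iff)
  obtain \<rho> where \<rho>: "\<rho> \<in> vertex_labelings (G \<times>\<^sub>w H)"
    and entry: "\<And>a b c d. \<lbrakk>a < card (pverts G); b < card (pverts H); c < card (pverts G); d < card (pverts H)\<rbrakk>
      \<Longrightarrow> adj_mat (G \<times>\<^sub>w H) \<rho> $$ (crt_index (card (pverts G)) (card (pverts H)) (a, b),
          crt_index (card (pverts G)) (card (pverts H)) (c, d))
        = adj_mat G \<sigma> $$ (a, c) * adj_mat H \<tau> $$ (b, d)"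
    using weak_product_labeling[OF \<sigma>(1) \<tau>(1) bij_betw_crt_index[OF cop pos]] by blast
  have "adj_mat (G \<times>\<^sub>w H) \<rho> \<in> carrier_mat (card (pverts G) * card (pverts H)) (card (pverts G) * card (pverts H))"
    using adj_mat_carrier[of "G \<times>\<^sub>w H" \<rho>] by (simp add: card_weak_product_pverts)
  from fourier_ratio_crt_product[OF cop pos adj_mat_carrier adj_mat_carrier this entry]
  have "fourier_ratio (adj_mat (G \<times>\<^sub>w H) \<rho>) = edge_complexity G * edge_complexity H"
    by (simp add: \<sigma> \<tau>)
  moreover have "finite (pverts (G \<times>\<^sub>w H))"
    using fin by (simp add: weak_product_def)
  ultimately show ?thesis
    using edge_complexity_le[OF _ \<rho>] by simp
qed

section \<open>Arc counts and the lower bound by the energy\<close>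

lemma card_parcs:
  assumes "pair_graph G"
  shows "card (parcs G) = 2 * num_edges G"
proof -
  interpret pair_graph G by fact
  let ?f = "\<lambda>(u, v). {u, v}"
  have sym: "sym (parcs G)"
    using sym_arcs by (simp add: symmetric_def)
  \<comment> \<open>Arcs are counted by fibres over undirected edges: symmetry provides both
    orientations, and the absence of loops makes them distinct.\<close>
  have "card (parcs G) = (\<Sum>e\<in>?f ` parcs G. card {a \<in> parcs G. ?f a = e})"
    unfolding card_eq_sum by (rule sum.image_gen[OF pair_finite_arcs])
  also have "\<dots> = (\<Sum>e\<in>?f ` parcs G. 2)"
  proof (rule sum.cong[OF refl])
    fix e assume "e \<in> ?f ` parcs G"
    then obtain u v where uv: "(u, v) \<in> parcs G" "e = {u, v}" by auto
    have "{a \<in> parcs G. ?f a = e} \<subseteq> {(u, v), (v, u)}"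
      unfolding uv(2) by (force simp: doubleton_eq_iff)
    moreover have "{(u, v), (v, u)} \<subseteq> {a \<in> parcs G. ?f a = e}"
      using uv(1) symD[OF sym uv(1)] unfolding uv(2) by blast
    ultimately have "{a \<in> parcs G. ?f a = e} = {(u, v), (v, u)}"
      by (rule subset_antisym)
    moreover have "u \<noteq> v" using no_loops'[OF uv(1)] .
    ultimately show "card {a \<in> parcs G. ?f a = e} = 2" by simp
  qed
  finally show ?thesis by (simp add: num_edges_def)
qed

text \<open>The entries are 0 or 1, so the sum of their squares counts arcs, whatever the
  labeling.\<close>

lemma frobenius_norm_adj_mat:
  assumes "pair_graph G" and \<sigma>: "\<sigma> \<in> vertex_labelings G"
  shows "frobenius_norm (adj_mat G \<sigma>) = sqrt (2 * real (num_edges G))"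
proof -
  interpret pair_graph G by fact
  let ?V = "pverts G" and ?n = "card (pverts G)"
  let ?g = "\<lambda>u v. if (u, v) \<in> parcs G then 1 else 0 :: real"
  have bs: "bij_betw (inv_into ?V \<sigma>) {..<?n} ?V"
    using \<sigma> bij_betw_inv_into by (auto simp: vertex_labelings_def)
  have "(\<Sum>x<?n. \<Sum>y<?n. (cmod (adj_mat G \<sigma> $$ (x, y)))\<^sup>2)
      = (\<Sum>x<?n. \<Sum>y<?n. ?g (inv_into ?V \<sigma> x) (inv_into ?V \<sigma> y))"
    by (intro sum.cong refl) (simp add: adj_mat_def)
  also have "\<dots> = (\<Sum>u\<in>?V. \<Sum>v\<in>?V. ?g u v)"
    using sum.reindex_bij_betw[OF bs, of "?g u" for u]
      sum.reindex_bij_betw[OF bs, of "\<lambda>u. \<Sum>v\<in>?V. ?g u v"] by simp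
  also have "\<dots> = (\<Sum>a\<in>?V \<times> ?V. if a \<in> parcs G then 1 else 0)"
    by (simp add: sum.cartesian_product case_prod_unfold)
  also have "\<dots> = real (card (?V \<times> ?V \<inter> parcs G))"
    by (simp add: sum.If_cases)
  also have "?V \<times> ?V \<inter> parcs G = parcs G"
    by (auto dest: in_arcsD1 in_arcsD2)
  finally show ?thesis
    using card_parcs[OF assms(1)] by (simp add: frobenius_norm_def adj_mat_def)
qed

text \<open>As F is unitary, the denominator of the Fourier ratio is the Frobenius norm of the
  adjacency matrix, the same for all labelings. The numerator is at least the energy.\<close>

lemma edge_complexity_ge:
  assumes "pair_graph G"
  shows "graph_energy G / sqrt (2 * real (num_edges G)) \<le> edge_complexity G"
proof -
  interpret pair_graph G by fact
  obtain \<sigma> where \<sigma>: "\<sigma> \<in> vertex_labelings G" "edge_complexity G = fourier_ratio (adj_mat G \<sigma>)"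
    using edge_complexity_attained[OF finite_verts] by auto
  let ?n = "card (pverts G)" and ?A = "adj_mat G \<sigma>"
  let ?F = "fourier_mat ?n"
  note U = unitary_fourier_mat[of ?n] and A = adj_mat_carrier[of G \<sigma>]
  have "frobenius_norm (?F * ?A * ?F) = sqrt (2 * real (num_edges G))"
    using frobenius_norm_unitary_right[OF U mult_carrier_mat[OF fourier_mat_carrier A]]
      frobenius_norm_unitary_left[OF U A] frobenius_norm_adj_mat[OF assms \<sigma>(1)] by simp
  then have "edge_complexity G = entrywise_l1_norm (?F * ?A * ?F) / sqrt (2 * real (num_edges G))"
    using A by (simp add: \<sigma>(2) fourier_ratio_def)
  then show ?thesis
    using mat_energy_le_entrywise_l1_norm[OF A U U] graph_energy_eq[OF \<sigma>(1)]
    by (simp add: divide_right_mono)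
qed

text \<open>Arcs multiply exactly, whereas a pair of undirected edges yields two edges of the
  product; this is why 2 s is the multiplicative quantity.\<close>

lemma card_parcs_weak_product: "card (parcs (G \<times>\<^sub>w H)) = card (parcs G) * card (parcs H)"
proof -
  have "bij_betw (\<lambda>((g1, g2), (h1, h2)). ((g1, h1), (g2, h2))) (parcs G \<times> parcs H) (parcs (G \<times>\<^sub>w H))"
    by (rule bij_betw_byWitness[where f' = "\<lambda>((g1, h1), (g2, h2)). ((g1, g2), (h1, h2))"])
       (auto simp: weak_product_def)
  from bij_betw_same_card[OF this] show ?thesis
    by (simp add: card_cartesian_product)
qed

lemma graph_energy_nonneg: "graph_energy G \<ge> 0"
  by (simp add: graph_energy_def mat_energy_def sum_nonneg)

theorem proposition3p7:
  fixes G :: "'a pair_pre_digraph" and H :: "'b pair_pre_digraph"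
  assumes "pair_graph G" and "pair_graph H"
    and "coprime (card (pverts G)) (card (pverts H))"
    and "num_edges G > 0" and "num_edges H > 0"
  shows "energy_gap (G \<times>\<^sub>w H) \<le> energy_gap G * energy_gap H
    \<and> (edge_complexity G = graph_energy G / sqrt (2 * real (num_edges G))
        \<and> edge_complexity H = graph_energy H / sqrt (2 * real (num_edges H))
      \<longrightarrow> edge_complexity (G \<times>\<^sub>w H) =
          graph_energy (G \<times>\<^sub>w H) / sqrt (2 * real (num_edges (G \<times>\<^sub>w H))))"
proof -
  interpret G: pair_graph G by fact
  interpret H: pair_graph H by fact
  have "parcs G \<noteq> {}" "parcs H \<noteq> {}"
    using assms(4,5) by (auto simp: num_edges_def)
  then have ne: "pverts G \<noteq> {}" "pverts H \<noteq> {}"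
    using G.in_arcsD1 H.in_arcsD1 by (auto simp: subset_iff)
  note le = edge_complexity_weak_product_le[OF G.finite_verts H.finite_verts ne assms(3)]
  have edges: "2 * real (num_edges (G \<times>\<^sub>w H)) = 2 * real (num_edges G) * (2 * real (num_edges H))"
    using arg_cong[where f = real, OF card_parcs_weak_product[of G H]]
    unfolding card_parcs[OF assms(1)] card_parcs[OF assms(2)]
      card_parcs[OF pair_graph_weak_product[OF assms(1,2)]] by simp
  \<comment> \<open>The energy benchmark is multiplicative, so both claims reduce to the bounds on
    \<open>edge_complexity\<close>.\<close>
  have bound: "graph_energy (G \<times>\<^sub>w H) / sqrt (2 * real (num_edges (G \<times>\<^sub>w H)))
      = (graph_energy G / sqrt (2 * real (num_edges G))) * (graph_energy H / sqrt (2 * real (num_edges H)))"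
    unfolding edges graph_energy_weak_product[OF G.finite_verts H.finite_verts] real_sqrt_mult
    by simp
  \<comment> \<open>Both sides have the same nonnegative denominator; were it zero, both quotients
    would be 0 by convention.\<close>
  have "energy_gap (G \<times>\<^sub>w H) \<le> energy_gap G * energy_gap H"
    unfolding energy_gap_def bound times_divide_times_eq
    by (intro divide_right_mono le mult_nonneg_nonneg divide_nonneg_nonneg) (auto intro: graph_energy_nonneg)
  \<comment> \<open>When both factors attain the benchmark, the product bound from above meets the
    general energy bound from below.\<close>
  moreover have "edge_complexity (G \<times>\<^sub>w H) = graph_energy (G \<times>\<^sub>w H) / sqrt (2 * real (num_edges (G \<times>\<^sub>w H)))"
    if "edge_complexity G = graph_energy G / sqrt (2 * real (num_edges G))"
      and "edge_complexity H = graph_energy H / sqrt (2 * real (num_edges H))"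
    using le edge_complexity_ge[OF pair_graph_weak_product[OF assms(1,2)]]
    unfolding bound that by (rule order.antisym)
  ultimately show ?thesis by blast
qed

end
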